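(* Let $B=(V,A)$ be an orientation of a complete bipartite graph (with two nonempty parts) such that the oriented diameter of $B$ is at most three, i.e. for every ordered pair of vertices $u,v$ there is a dipath from $u$ to $v$ of length at most $3$. Then $|L(B)|\ge |V|$ or $V\in L(B)$.
   Context: All digraphs are finite. An orientation of a graph is obtained by replacing each edge $\{u,v\}$ by exactly one of the arcs $uv$, $vu$. A dipath is a directed path. For vertices $x,y$ of a digraph $D=(V,A)$, $[x,y]$ denotes the set of all vertices $z$ such that some shortest dipath from $x$ to $y$ contains $z$. For an ordered pair of distinct vertices $(x,y)$, the line it defines is $\overrightarrow{xy}=\{z\in V : x\in[z,y] \text{ or } y\in[x,z] \text{ or } z\in[x,y]\}$. $L(D)$ denotes the set of all lines $\overrightarrow{xy}$ over ordered pairs of distinct vertices $x,y$ of $D$ (as a set of subsets of $V$, so equal lines are counted once). A digraph $D=(V,A)$ is said to satisfy Chen and Chvátal's conjecture if $V\in L(D)$ or $|L(D)|\ge|V|$. *)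

theory Defs
  imports "Graph_Theory.Graph_Theory"
begin

text \<open>
  Undirected graphs are symmetric digraphs: each edge \<open>{u, v}\<close> of \<open>G\<close> appears in
  \<open>arcs_ends G\<close> as both \<open>(u, v)\<close> and \<open>(v, u)\<close>. The locale predicate \<open>digraph B\<close> excludes
  parallel arcs, so exactly one arc of \<open>B\<close> replaces each edge.
\<close>

definition orientation_of :: "('a, 'b) pre_digraph \<Rightarrow> ('a, 'c) pre_digraph \<Rightarrow> bool" where
  "orientation_of B G \<longleftrightarrow>
     graph G \<and> digraph B \<and> verts B = verts G \<and> arcs_ends B \<subseteq> arcs_ends G \<and>
     (\<forall>(u, v) \<in> arcs_ends G. ((u, v) \<in> arcs_ends B) \<noteq> ((v, u) \<in> arcs_ends B))"

context pre_digraph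
begin

definition shortest_apath :: "'a \<Rightarrow> 'b awalk \<Rightarrow> 'a \<Rightarrow> bool" where
  "shortest_apath x p y \<longleftrightarrow> apath x p y \<and> (\<forall>q. apath x q y \<longrightarrow> length p \<le> length q)"

text \<open>The interval \<open>[x, y]\<close>; it is empty if there is no dipath from \<open>x\<close> to \<open>y\<close>.\<close>

definition interval :: "'a \<Rightarrow> 'a \<Rightarrow> 'a set" where
  "interval x y = {z. \<exists>p. shortest_apath x p y \<and> z \<in> set (awalk_verts x p)}"

definition line :: "'a \<Rightarrow> 'a \<Rightarrow> 'a set" where
  "line x y = {z \<in> verts G. x \<in> interval z y \<or> y \<in> interval x z \<or> z \<in> interval x y}"

definition lines :: "'a set set" where
  "lines = {line x y | x y. x \<in> verts G \<and> y \<in> verts G \<and> x \<noteq> y}"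

end

end

theory Submission
  imports Defs
begin

text \<open>
  In a bipartite digraph the parity of a distance is fixed by the parts of its end points. As no
  distance exceeds three, all distances are therefore known: two distinct vertices of the same part
  are at distance two in both directions, and across an arc \<open>u \<rightarrow> v\<close> the distances are one from \<open>u\<close>
  to \<open>v\<close> and three back. Lines can then be read off. The line of an arc \<open>a \<rightarrow> b\<close> consists of \<open>a\<close>, \<open>b\<close>,
  the out-neighbours of \<open>b\<close> and the in-neighbours of \<open>a\<close> (\<open>line_arc\<close>); the line of two vertices of a
  part meets that part in these two vertices only (\<open>line_pair_Int_part\<close>).

  If some vertex has out-degree or in-degree one, the arc that witnesses this has a universal line
  (\<open>line_eq_verts_if_unique_out_arc\<close>, \<open>line_eq_verts_if_unique_in_arc\<close>). Otherwise all in-degrees and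
  out-degrees are at least two. Then each part has at least four vertices, and the line of an
  arc meets each part in at least three vertices, so that it is not the line of a pair of vertices
  of one part. For a part with \<open>k \<ge> 4\<close> vertices this gives \<open>k choose 2\<close> lines that meet
  the part in two vertices, and two further ones from two arcs with a common head; together these
  are at least \<open>2 * k\<close>. Applied to both parts, this bounds the number of vertices by the
  number of lines.
\<close>

(* The arrow then denotes only the arc relation, not also a set of functions. *)
unbundle no funcset_syntax

section \<open>Bipartite tournaments of diameter at most three\<close>

text \<open>
  The hypotheses are symmetric in the two parts, so every result about \<open>Y\<close> is also available for
  \<open>X\<close>, through \<open>swap_parts\<close>.
\<close>

locale bipartite_tournament_diam3 = fin_digraph G for G :: "('a, 'b) pre_digraph" (structure) +
  fixes X Y :: "'a set"
  assumes verts_eq: "verts G = X \<union> Y"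
    and parts_disjoint: "X \<inter> Y = {}"
    and parts_nonempty: "X \<noteq> {}" "Y \<noteq> {}"
    and arc_between_parts: "u \<rightarrow> v \<Longrightarrow> (u \<in> X) \<noteq> (v \<in> X)"
    and one_arc: "u \<in> X \<Longrightarrow> v \<in> Y \<Longrightarrow> (u \<rightarrow> v) \<noteq> (v \<rightarrow> u)"
    and diam3: "u \<in> verts G \<Longrightarrow> v \<in> verts G \<Longrightarrow> \<exists>p. apath u p v \<and> length p \<le> 3"
begin

lemma swap_parts: "bipartite_tournament_diam3 G Y X"
proof
  show "(u \<in> Y) \<noteq> (v \<in> Y)" if "u \<rightarrow> v" for u v
  proof -
    from that have "u \<in> X \<union> Y" "v \<in> X \<union> Y"
      unfolding verts_eq[symmetric] by auto
    then show ?thesis using arc_between_parts[OF that] parts_disjoint by blast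
  qed
qed (use verts_eq parts_disjoint parts_nonempty one_arc diam3 in auto)

lemma arc_in_verts: "u \<rightarrow> v \<Longrightarrow> u \<in> verts G \<and> v \<in> verts G"
  by auto

lemma arc_reverse_iff:
  assumes "u \<in> verts G" "v \<in> verts G" "(u \<in> X) \<noteq> (v \<in> X)"
  shows "v \<rightarrow> u \<longleftrightarrow> \<not> u \<rightarrow> v"
  using assms one_arc[of u v] one_arc[of v u] verts_eq by auto

section \<open>Distances and intervals\<close>

text \<open>
  A closed form for the distance; \<open>shortest_apath_iff\<close> shows that it is the length of
  the shortest dipaths.
\<close>
definition gdist :: "'a \<Rightarrow> 'a \<Rightarrow> nat" where
  "gdist u v = (if u = v then 0 else if (u \<in> X) = (v \<in> X) then 2 else if u \<rightarrow> v then 1 else 3)"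

lemma awalk_parity: "awalk u p v \<Longrightarrow> even (length p) \<longleftrightarrow> (u \<in> X) = (v \<in> X)"
proof (induction p arbitrary: u)
  case (Cons e p)
  then have "u \<rightarrow> head G e" by (auto simp: awalk_Cons_iff intro: in_arcs_imp_in_arcs_ends)
  with Cons show ?case by (auto simp: awalk_Cons_iff dest: arc_between_parts)
qed (auto simp: awalk_Nil_iff)

lemma gdist_le_length:
  assumes "awalk u p v"
  shows "gdist u v \<le> length p"
proof -
  have "length p = 0 \<longrightarrow> u = v"
    using assms by (auto simp: awalk_Nil_iff)
  moreover have "u \<rightarrow> v" if "length p = 1"
    using assms that by (cases p) (auto simp: awalk_simps intro: in_arcs_imp_in_arcs_ends)
  moreover have "length p = 0 \<or> length p = 1 \<or> length p = 2 \<or> length p \<ge> 3" by linarith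
  ultimately show ?thesis
    using awalk_parity[OF assms] unfolding gdist_def by auto
qed

text \<open>
  Cutting a closed subwalk out of such a walk would leave a walk that is too short.
\<close>
lemma apath_if_awalk_of_length_gdist:
  assumes "awalk u p v" "length p = gdist u v"
  shows "apath u p v"
proof (rule ccontr)
  assume "\<not> apath u p v"
  then have "\<not> distinct (awalk_verts u p)" using assms by (auto simp: apath_def)
  then obtain q r s w where "p = q @ r @ s" "awalk u q w" "awalk w r w" "awalk w s v" "r \<noteq> []"
    using awalk_not_distinct_decomp[OF assms(1)] by blast
  then have "awalk u (q @ s) v" "length (q @ s) < length p" by (auto intro: awalk_appendI)
  then show False using gdist_le_length[of u "q @ s" v] assms(2) by simp
qed

text \<open>
  Without an arc from \<open>u\<close> to \<open>v\<close>, a dipath of length at most three has only one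
  length that its parity permits.
\<close>
lemma apath_of_length_gdist:
  assumes "u \<in> verts G" "v \<in> verts G"
  obtains p where "apath u p v" "length p = gdist u v"
proof (cases "u \<rightarrow> v")
  case True
  then obtain e where e: "e \<in> arcs G" "tail G e = u" "head G e = v" by auto
  have "awalk u [e] v" using arc_implies_awalk[OF e(1)] e by simp
  moreover have "length [e] = gdist u v"
    using True arc_between_parts[OF True] by (auto simp: gdist_def)
  ultimately show ?thesis using that apath_if_awalk_of_length_gdist by blast
next
  case False
  obtain p where p: "apath u p v" "length p \<le> 3" using diam3 assms by blast
  then have aw: "awalk u p v" by (rule_tac awalkI_apath)
  have "length p = 0 \<longleftrightarrow> u = v"
    using p(1) apath_nonempty_ends[OF p(1)] by (auto simp: apath_Nil_iff)
  moreover have "length p = 0 \<or> length p = 1 \<or> length p = 2 \<or> length p = 3"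
    using p(2) by linarith
  ultimately have "length p = gdist u v"
    using awalk_parity[OF aw] gdist_le_length[OF aw] False unfolding gdist_def
    by (auto split: if_splits)
  with p(1) that show ?thesis by blast
qed

lemma shortest_apath_iff:
  "shortest_apath u p v \<longleftrightarrow> awalk u p v \<and> length p = gdist u v"
proof
  assume sp: "shortest_apath u p v"
  then have aw: "awalk u p v" by (auto simp: shortest_apath_def apath_def)
  then obtain q where "apath u q v" "length q = gdist u v"
    using apath_of_length_gdist[of u v] by (metis awalk_hd_in_verts awalk_last_in_verts)
  with sp have "length p \<le> gdist u v" by (auto simp: shortest_apath_def)
  with aw gdist_le_length[OF aw] show "awalk u p v \<and> length p = gdist u v" by simp
next
  assume "awalk u p v \<and> length p = gdist u v"
  then show "shortest_apath u p v"
    unfolding shortest_apath_def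
    using apath_if_awalk_of_length_gdist gdist_le_length awalkI_apath by metis
qed

lemma interval_iff:
  assumes "u \<in> verts G" "v \<in> verts G" "w \<in> verts G"
  shows "w \<in> interval u v \<longleftrightarrow> gdist u w + gdist w v = gdist u v"
proof
  assume "w \<in> interval u v"
  then obtain p where p: "awalk u p v" "length p = gdist u v" "w \<in> set (awalk_verts u p)"
    by (auto simp: interval_def shortest_apath_iff)
  obtain q r where qr: "p = q @ r" "awalk u q w" "awalk w r v"
    using awalk_decomp[OF p(1,3)] by blast
  obtain q' where q': "awalk u q' w" "length q' = gdist u w"
    using apath_of_length_gdist[of u w] assms awalkI_apath by metis
  obtain r' where r': "awalk w r' v" "length r' = gdist w v"
    using apath_of_length_gdist[of w v] assms awalkI_apath by metis
  have "gdist u v \<le> gdist u w + gdist w v"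
    using gdist_le_length[of u "q' @ r'" v] q' r' by (auto simp: awalk_appendI)
  then show "gdist u w + gdist w v = gdist u v"
    using gdist_le_length[OF qr(2)] gdist_le_length[OF qr(3)] p(2) qr(1) by simp
next
  assume eq: "gdist u w + gdist w v = gdist u v"
  obtain q where q: "awalk u q w" "length q = gdist u w"
    using apath_of_length_gdist[of u w] assms awalkI_apath by metis
  obtain r where r: "awalk w r v" "length r = gdist w v"
    using apath_of_length_gdist[of w v] assms awalkI_apath by metis
  have "awalk u (q @ r) v" using q r by (auto intro: awalk_appendI)
  moreover have "w \<in> set (awalk_verts u (q @ r))"
    using calculation q(1) r(1) by (metis UnI2 awalk_verts_ne_eq hd_in_awalk_verts(1) set_awalk_verts_append)
  ultimately show "w \<in> interval u v"
    using eq q(2) r(2) unfolding interval_def shortest_apath_iff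
    by (intro CollectI exI[of _ "q @ r"]) simp
qed

text \<open>With this, membership in a line is arithmetic with the closed form for distances.\<close>
lemma line_iff:
  assumes "u \<in> verts G" "v \<in> verts G"
  shows "w \<in> line u v \<longleftrightarrow> w \<in> verts G \<and>
    (gdist w u + gdist u v = gdist w v \<or> gdist u v + gdist v w = gdist u w \<or> gdist u w + gdist w v = gdist u v)"
  using assms interval_iff by (auto simp: line_def)

section \<open>Lines\<close>

text \<open>
  No vertex lies strictly between \<open>a\<close> and \<open>b\<close>. One in the part of \<open>a\<close> is at distance two from \<open>a\<close>, so
  it is on the line only if its distance to or from \<open>b\<close> fits: \<open>2 + 1 = 3\<close> to \<open>b\<close>, or \<open>1 + 1 = 2\<close> through
  \<open>b\<close>, and both say that \<open>b \<rightarrow> z\<close>. The part of \<open>b\<close> is dual.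
\<close>
lemma line_arc:
  assumes "a \<rightarrow> b"
  shows "line a b = {a, b} \<union> {z. b \<rightarrow> z} \<union> {z. z \<rightarrow> a}"
proof (rule set_eqI)
  fix z
  have ab: "a \<in> verts G" "b \<in> verts G" "(a \<in> X) \<noteq> (b \<in> X)" "a \<noteq> b"
    using arc_in_verts[OF assms] arc_between_parts[OF assms] by auto
  show "z \<in> line a b \<longleftrightarrow> z \<in> {a, b} \<union> {z. b \<rightarrow> z} \<union> {z. z \<rightarrow> a}"
  proof (cases "z \<in> verts G \<and> z \<noteq> a \<and> z \<noteq> b")
    case True
    then have z: "z \<in> verts G" "z \<noteq> a" "z \<noteq> b" by auto
    show ?thesis
    proof (cases "(z \<in> X) = (a \<in> X)")
      case same: True
      then have "z \<rightarrow> b \<longleftrightarrow> \<not> b \<rightarrow> z" "\<not> z \<rightarrow> a"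
        using arc_reverse_iff[OF ab(2) z(1)] arc_between_parts[of z a] ab(3) by metis+
      with same show ?thesis
        using assms ab z by (simp add: line_iff gdist_def)
    next
      case opposite: False
      then have "a \<rightarrow> z \<longleftrightarrow> \<not> z \<rightarrow> a" "\<not> b \<rightarrow> z"
        using arc_reverse_iff[OF z(1) ab(1)] arc_between_parts[of b z] ab(3) by metis+
      with opposite show ?thesis
        using assms ab z by (simp add: line_iff gdist_def)
    qed
  next
    case False
    moreover have "{a, b} \<subseteq> line a b" using ab by (simp add: line_iff gdist_def)
    ultimately show ?thesis
      using ab arc_in_verts[of b z] arc_in_verts[of z a] by (auto simp: line_iff)
  qed
qed

text \<open>Three vertices of the same part are pairwise at distance two, and \<open>2 + 2 \<noteq> 2\<close>.\<close>
lemma line_pair_Int_part: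
  assumes "u \<in> Y" "v \<in> Y" "u \<noteq> v"
  shows "line u v \<inter> Y = {u, v}"
proof -
  have "u \<notin> X" "v \<notin> X" "u \<in> verts G" "v \<in> verts G"
    using assms parts_disjoint verts_eq by auto
  then show ?thesis
    using assms parts_disjoint verts_eq by (auto simp: line_iff gdist_def split: if_splits)
qed

section \<open>Vertices of degree one\<close>

lemma two_step:
  assumes "u \<in> verts G" "v \<in> verts G" "u \<noteq> v" "(u \<in> X) = (v \<in> X)"
  obtains w where "u \<rightarrow> w" "w \<rightarrow> v"
proof -
  obtain p where p: "awalk u p v" "length p = gdist u v"
    using apath_of_length_gdist[of u v] assms awalkI_apath by metis
  have "length p = Suc (Suc 0)" using p(2) assms by (simp add: gdist_def)
  then obtain e f where "p = [e, f]" by (auto simp: length_Suc_conv)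
  with p(1) have "u \<rightarrow> head G e" "head G e \<rightarrow> v"
    using in_arcs_imp_in_arcs_ends[of e] in_arcs_imp_in_arcs_ends[of f] by (auto simp: awalk_simps)
  then show ?thesis by (rule that)
qed

lemma ex_out_arc:
  assumes "u \<in> verts G"
  obtains v where "u \<rightarrow> v"
proof -
  obtain v where v: "v \<in> verts G" "v \<noteq> u"
    using assms parts_disjoint parts_nonempty verts_eq by blast
  obtain p where "awalk u p v"
    using apath_of_length_gdist[of u v] assms v awalkI_apath by metis
  with v that show ?thesis
    by (cases p) (auto simp: awalk_simps dest: in_arcs_imp_in_arcs_ends)
qed

lemma ex_in_arc:
  assumes "v \<in> verts G"
  obtains u where "u \<rightarrow> v"
proof -
  obtain u where u: "u \<in> verts G" "u \<noteq> v"
    using assms parts_disjoint parts_nonempty verts_eq by blast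
  obtain p where "awalk u p v"
    using apath_of_length_gdist[of u v] assms u awalkI_apath by metis
  with u that show ?thesis
    by (cases p rule: rev_cases) (auto simp: awalk_simps dest: in_arcs_imp_in_arcs_ends)
qed

text \<open>
  A dipath of length two from \<open>a\<close> to another vertex of its part must pass through \<open>b\<close>, so that vertex
  is an out-neighbour of \<open>b\<close>. Any vertex other than \<open>b\<close> in the part of \<open>b\<close> is not an out-neighbour of
  \<open>a\<close>, hence an in-neighbour of it. Both kinds belong to the line of the arc. The next lemma is dual.
\<close>
lemma line_eq_verts_if_unique_out_arc:
  assumes ab: "a \<rightarrow> b" and unique: "\<And>c. a \<rightarrow> c \<Longrightarrow> c = b"
  shows "line a b = verts G"
proof -
  have abv: "a \<in> verts G" "b \<in> verts G" "(a \<in> X) \<noteq> (b \<in> X)"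
    using arc_in_verts[OF ab] arc_between_parts[OF ab] by auto
  have "z \<in> line a b" if z: "z \<in> verts G" for z
  proof (cases "z = a \<or> z = b")
    case False
    show ?thesis
    proof (cases "(z \<in> X) = (a \<in> X)")
      case True
      then have "b \<rightarrow> z" using two_step[of a z] abv z False unique by metis
      then show ?thesis by (simp add: line_arc[OF ab])
    next
      case opposite: False
      then have "z \<rightarrow> a" using arc_reverse_iff[of a z] abv z False unique by blast
      then show ?thesis by (simp add: line_arc[OF ab])
    qed
  qed (auto simp: line_arc[OF ab])
  then show ?thesis by (auto simp: line_def)
qed

lemma line_eq_verts_if_unique_in_arc:
  assumes ab: "a \<rightarrow> b" and unique: "\<And>c. c \<rightarrow> b \<Longrightarrow> c = a"
  shows "line a b = verts G"
proof -
  have abv: "a \<in> verts G" "b \<in> verts G" "(a \<in> X) \<noteq> (b \<in> X)"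
    using arc_in_verts[OF ab] arc_between_parts[OF ab] by auto
  have "z \<in> line a b" if z: "z \<in> verts G" for z
  proof (cases "z = a \<or> z = b")
    case False
    show ?thesis
    proof (cases "(z \<in> X) = (b \<in> X)")
      case True
      then have "z \<rightarrow> a" using two_step[of z b] abv z False unique by metis
      then show ?thesis by (simp add: line_arc[OF ab])
    next
      case opposite: False
      then have "b \<rightarrow> z" using arc_reverse_iff[of z b] abv z False unique by blast
      then show ?thesis by (simp add: line_arc[OF ab])
    qed
  qed (auto simp: line_arc[OF ab])
  then show ?thesis by (auto simp: line_def)
qed

lemma line_of_arc_in_lines:
  assumes "a \<rightarrow> b"
  shows "line a b \<in> lines"
proof -
  have "a \<in> verts G" "b \<in> verts G" "a \<noteq> b"
    using arc_in_verts[OF assms] arc_between_parts[OF assms] by auto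
  then show ?thesis unfolding lines_def by blast
qed

lemma two_out_arcs:
  assumes "verts G \<notin> lines" "u \<in> verts G"
  obtains v w where "u \<rightarrow> v" "u \<rightarrow> w" "v \<noteq> w"
proof -
  obtain v where v: "u \<rightarrow> v" using ex_out_arc[OF assms(2)] .
  then have "line u v \<noteq> verts G" using line_of_arc_in_lines assms(1) by metis
  then obtain w where "u \<rightarrow> w" "w \<noteq> v"
    using line_eq_verts_if_unique_out_arc[OF v] by blast
  with v that show ?thesis by blast
qed

lemma two_in_arcs:
  assumes "verts G \<notin> lines" "v \<in> verts G"
  obtains u w where "u \<rightarrow> v" "w \<rightarrow> v" "u \<noteq> w"
proof -
  obtain u where u: "u \<rightarrow> v" using ex_in_arc[OF assms(2)] .
  then have "line u v \<noteq> verts G" using line_of_arc_in_lines assms(1) by metis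
  then obtain w where "w \<rightarrow> v" "w \<noteq> u"
    using line_eq_verts_if_unique_in_arc[OF u] by blast
  with u that show ?thesis by blast
qed

section \<open>Counting lines\<close>

lemma finite_lines: "finite lines"
proof (rule finite_subset)
  show "lines \<subseteq> Pow (verts G)" by (auto simp: lines_def line_def)
qed simp

lemma pairs_of_part_subset_traces: "{S. S \<subseteq> Y \<and> card S = 2} \<subseteq> (\<lambda>L. L \<inter> Y) ` {L \<in> lines. card (L \<inter> Y) = 2}"
proof
  fix S assume "S \<in> {S. S \<subseteq> Y \<and> card S = 2}"
  then obtain u v where uv: "S = {u, v}" "u \<noteq> v" "u \<in> Y" "v \<in> Y"
    by (auto simp: card_2_iff)
  then have "line u v \<in> lines" unfolding lines_def using verts_eq by blast
  with line_pair_Int_part[OF uv(3,4,2)] uv show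
    "S \<in> (\<lambda>L. L \<inter> Y) ` {L \<in> lines. card (L \<inter> Y) = 2}"
    by (intro image_eqI[of _ _ "line u v"]) auto
qed

lemma finite_Y: "finite Y"
  using finite_verts verts_eq by (metis finite_Un)

text \<open>Distinct pairs in \<open>Y\<close> have distinct lines, because a pair is the trace of its line on \<open>Y\<close>.\<close>
lemma choose_2_le_card_pair_lines: "card Y choose 2 \<le> card {L \<in> lines. card (L \<inter> Y) = 2}"
proof -
  have "card Y choose 2 = card {S. S \<subseteq> Y \<and> card S = 2}"
    using n_subsets[OF finite_Y] by simp
  also have "\<dots> \<le> card {L \<in> lines. card (L \<inter> Y) = 2}"
    by (rule surj_card_le[OF _ pairs_of_part_subset_traces]) (simp add: finite_lines)
  finally show ?thesis .
qed

text \<open>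
  Two arcs \<open>a \<rightarrow> b\<close> and \<open>a' \<rightarrow> b\<close> into the same vertex have different lines: \<open>a'\<close> is in the part of \<open>a\<close>,
  where the line of \<open>a \<rightarrow> b\<close> contains, apart from \<open>a\<close>, only out-neighbours of \<open>b\<close>. Both lines meet the part of
  \<open>b\<close> in three vertices at least: \<open>b\<close> and two in-neighbours of the tail.
\<close>
lemma two_le_card_arc_lines:
  assumes "verts G \<notin> lines"
  shows "2 \<le> card {L \<in> lines. card (L \<inter> Y) \<ge> 3}"
proof -
  obtain b where b: "b \<in> Y" using parts_nonempty by blast
  then have bX: "b \<notin> X" "b \<in> verts G" using parts_disjoint verts_eq by auto
  obtain a a' where a: "a \<rightarrow> b" "a' \<rightarrow> b" "a \<noteq> a'"
    using two_in_arcs[OF assms bX(2)] .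
  have large: "card (line c b \<inter> Y) \<ge> 3" if c: "c \<rightarrow> b" for c
  proof -
    have cX: "c \<in> X" using arc_between_parts[OF c] bX by simp
    then obtain y y' where y: "y \<rightarrow> c" "y' \<rightarrow> c" "y \<noteq> y'"
      using two_in_arcs[OF assms, of c] verts_eq by blast
    have "y \<in> Y" "y' \<in> Y"
      using y arc_between_parts arc_in_verts cX verts_eq by blast+
    moreover have "y \<noteq> b" "y' \<noteq> b" using one_arc[OF cX b] c y by auto
    ultimately have "{b, y, y'} \<subseteq> line c b \<inter> Y" "card {b, y, y'} = 3"
      using y b by (auto simp: line_arc[OF c])
    then show ?thesis using card_mono[of "line c b \<inter> Y"] finite_Y by (metis finite_Int)
  qed
  have "a \<in> X" "a' \<in> X" using a arc_between_parts bX by blast+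
  then have "a' \<notin> line a b"
    using a one_arc[of a' b] b arc_between_parts[of a' a] bX by (auto simp: line_arc[OF a(1)])
  moreover have "a' \<in> line a' b" by (simp add: line_arc[OF a(2)])
  ultimately have "card {line a b, line a' b} = 2" by (metis card_2_iff)
  moreover have "{line a b, line a' b} \<subseteq> {L \<in> lines. card (L \<inter> Y) \<ge> 3}"
    using a large line_of_arc_in_lines by auto
  ultimately show ?thesis
    using card_mono[of "{L \<in> lines. card (L \<inter> Y) \<ge> 3}"] finite_lines by (metis (no_types, lifting) finite_Collect_conjI mem_Collect_eq finite_subset subsetI)
qed

text \<open>Any vertex of \<open>X\<close> has two out-neighbours and two in-neighbours, all in \<open>Y\<close>.\<close>
lemma four_le_card_part:
  assumes "verts G \<notin> lines"
  shows "4 \<le> card Y"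
proof -
  obtain x where x: "x \<in> X" "x \<in> verts G" using parts_nonempty verts_eq by auto
  obtain a b where ab: "x \<rightarrow> a" "x \<rightarrow> b" "a \<noteq> b" using two_out_arcs[OF assms x(2)] .
  obtain c d where cd: "c \<rightarrow> x" "d \<rightarrow> x" "c \<noteq> d" using two_in_arcs[OF assms x(2)] .
  have Y: "{a, b, c, d} \<subseteq> Y"
    using ab cd arc_between_parts arc_in_verts x verts_eq by blast
  moreover have "card {a, b, c, d} = 4"
    using ab cd one_arc[OF x(1)] Y by (auto simp: card_insert_if)
  ultimately show ?thesis using card_mono[OF finite_Y] by metis
qed

lemma twice_le_choose_2: "4 \<le> (n::nat) \<Longrightarrow> 2 * n \<le> (n choose 2) + 2"
proof (induction n rule: nat_induct_at_least)
  case (Suc n)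
  then show ?case by (simp add: numeral_2_eq_2)
qed (simp add: choose_two)

lemma twice_card_part_le_card_lines:
  assumes "verts G \<notin> lines"
  shows "2 * card Y \<le> card lines"
proof -
  have "2 * card Y \<le> (card Y choose 2) + 2"
    by (rule twice_le_choose_2[OF four_le_card_part[OF assms]])
  also have "\<dots> \<le> card {L \<in> lines. card (L \<inter> Y) = 2} + card {L \<in> lines. card (L \<inter> Y) \<ge> 3}"
    by (rule add_mono[OF choose_2_le_card_pair_lines two_le_card_arc_lines[OF assms]])
  also have "\<dots> = card ({L \<in> lines. card (L \<inter> Y) = 2} \<union> {L \<in> lines. card (L \<inter> Y) \<ge> 3})"
    by (rule card_Un_disjoint[symmetric]) (auto simp: finite_lines)
  also have "\<dots> \<le> card lines"
    by (rule card_mono) (auto simp: finite_lines)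
  finally show ?thesis .
qed

end

theorem theorem12:
  fixes B :: "('a, 'b) pre_digraph" and K :: "('a, 'c) pre_digraph" and m n :: nat
  assumes "complete_bipartite_digraph m n K" and "m \<ge> 1" and "n \<ge> 1"
    and "orientation_of B K"
    and "\<forall>u \<in> verts B. \<forall>v \<in> verts B. \<exists>p. pre_digraph.apath B u p v \<and> length p \<le> 3"
  shows "card (pre_digraph.lines B) \<ge> card (verts B) \<or> verts B \<in> pre_digraph.lines B"
proof (rule disjCI)
  assume no_universal: "verts B \<notin> pre_digraph.lines B"
  obtain X Y where XY: "verts K = X \<union> Y" "X \<inter> Y = {}" "card X = m" "card Y = n"
    "arcs_ends K = X \<times> Y \<union> Y \<times> X"
    using assms(1) unfolding complete_bipartite_digraph_def by blast
  have B: "digraph B" "verts B = X \<union> Y" "arcs_ends B \<subseteq> X \<times> Y \<union> Y \<times> X"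
    "\<And>u v. (u, v) \<in> X \<times> Y \<union> Y \<times> X \<Longrightarrow> ((u, v) \<in> arcs_ends B) \<noteq> ((v, u) \<in> arcs_ends B)"
    using assms(4) XY unfolding orientation_of_def by auto
  interpret digraph B by (rule B(1))
  interpret X: bipartite_tournament_diam3 B X Y
  proof
    show "X \<noteq> {}" "Y \<noteq> {}" using XY assms(2,3) by auto
    show "(u \<in> X) \<noteq> (v \<in> X)" if "u \<rightarrow>\<^bsub>B\<^esub> v" for u v
      using that B(3) XY(2) by blast
    show "(u \<rightarrow>\<^bsub>B\<^esub> v) \<noteq> (v \<rightarrow>\<^bsub>B\<^esub> u)" if "u \<in> X" "v \<in> Y" for u v
      using B(4) that by blast
  qed (use B XY assms(5) in auto)
  interpret Y: bipartite_tournament_diam3 B Y X by (rule X.swap_parts)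
  have "card (verts B) \<le> card X + card Y" unfolding B(2) by (rule card_Un_le)
  moreover have "2 * card Y \<le> card lines" "2 * card X \<le> card lines"
    using X.twice_card_part_le_card_lines Y.twice_card_part_le_card_lines no_universal by auto
  ultimately show "card (verts B) \<le> card lines" by linarith
qed

end
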